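(* Let $V$ be a finite set, let $\omega_1,\omega_2:V\times V\to[0,\infty)$ be two (symmetric) weight functions, and let $d_{\omega_1},d_{\omega_2}$ be the corresponding degree functions. Let $D_i=\sum_{s\in V}d_{\omega_i}(s)$ be the total degree for $\omega_i$, and let $$\delta=\sum_{s\in V}\left(\frac{\left|d_{\omega_1}(s)-\frac{D_1}{|V|}\right|}{D_1}+\frac{\left|d_{\omega_2}(s)-\frac{D_2}{|V|}\right|}{D_2}\right).$$ Then $$\|A^0_{\omega_1+\omega_2}\|\le\delta+(1-\delta)\max\left(\|A^0_{\omega_1}\|,\|A^0_{\omega_2}\|\right).$$
   Context: For a symmetric weight $\omega:V\times V\to[0,\infty)$, the degree is $d_\omega(s)=\sum_{t\in V}\omega(s,t)$, $L^2(V,d_\omega)$ is the space of functions on $V$ with inner product $\langle f,g\rangle=\sum_sf(s)\overline{g(s)}d_\omega(s)$, and the Markov operator is $A_\omega f(s)=\frac1{d_\omega(s)}\sum_t\omega(s,t)f(t)$ (the degrees being understood to be positive so that these operators are defined). $L^2_0(V,d_\omega)$ is the orthogonal complement of the constant functions in $L^2(V,d_\omega)$, and $A^0_\omega$ is the restriction of $A_\omega$ to $L^2_0(V,d_\omega)$, with operator norm $\|A_\omega^0\|$. *)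

theory Defs
  imports "HOL-Analysis.Analysis"
begin

text \<open>
  The finite set \<open>V\<close> is rendered as a type of class \<^class>\<open>finite\<close>, so that functions on \<open>V\<close> are
  exactly the elements of the function type \<open>'v \<Rightarrow> complex\<close>.
\<close>

definition weight :: "('v \<Rightarrow> 'v \<Rightarrow> real) \<Rightarrow> bool" where
  "weight \<omega> \<longleftrightarrow> (\<forall>s t. 0 \<le> \<omega> s t) \<and> (\<forall>s t. \<omega> s t = \<omega> t s)"

definition wdegree :: "('v::finite \<Rightarrow> 'v \<Rightarrow> real) \<Rightarrow> 'v \<Rightarrow> real" where
  "wdegree \<omega> s = (\<Sum>t\<in>UNIV. \<omega> s t)"

definition total_degree :: "('v::finite \<Rightarrow> 'v \<Rightarrow> real) \<Rightarrow> real" where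
  "total_degree \<omega> = (\<Sum>s\<in>UNIV. wdegree \<omega> s)"

definition L2_inner :: "('v::finite \<Rightarrow> real) \<Rightarrow> ('v \<Rightarrow> complex) \<Rightarrow> ('v \<Rightarrow> complex) \<Rightarrow> complex" where
  "L2_inner d f g = (\<Sum>s\<in>UNIV. f s * cnj (g s) * of_real (d s))"

definition L2_norm :: "('v::finite \<Rightarrow> real) \<Rightarrow> ('v \<Rightarrow> complex) \<Rightarrow> real" where
  "L2_norm d f = sqrt (Re (L2_inner d f f))"

definition L2_0 :: "('v::finite \<Rightarrow> real) \<Rightarrow> ('v \<Rightarrow> complex) set" where
  "L2_0 d = {f. \<forall>c. L2_inner d f (\<lambda>_. c) = 0}"

definition markov_op :: "('v::finite \<Rightarrow> 'v \<Rightarrow> real) \<Rightarrow> ('v \<Rightarrow> complex) \<Rightarrow> 'v \<Rightarrow> complex" where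
  "markov_op \<omega> f s = 1 / of_real (wdegree \<omega> s) * (\<Sum>t\<in>UNIV. of_real (\<omega> s t) * f t)"

text \<open>
  Operator norm on a subspace \<open>S\<close> of \<open>L\<^sup>2(V,d)\<close>, in the form of the library's \<^const>\<open>onorm\<close>
  (which is tied to the canonical norm of a type). The zero function contributes \<open>0 / 0 = 0\<close>,
  so the norm is \<open>0\<close> when \<open>S\<close> is trivial.
\<close>

definition L2_opnorm_on ::
  "('v::finite \<Rightarrow> real) \<Rightarrow> ('v \<Rightarrow> complex) set \<Rightarrow> (('v \<Rightarrow> complex) \<Rightarrow> 'v \<Rightarrow> complex) \<Rightarrow> real" where
  "L2_opnorm_on d S T = (SUP f\<in>S. L2_norm d (T f) / L2_norm d f)"

definition markov_norm0 :: "('v::finite \<Rightarrow> 'v \<Rightarrow> real) \<Rightarrow> real" where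
  "markov_norm0 \<omega> = L2_opnorm_on (wdegree \<omega>) (L2_0 (wdegree \<omega>)) (markov_op \<omega>)"

text \<open>
  The restriction of the Markov operator to \<open>L\<^sup>2\<^sub>0\<close> is an operator on that space, and the supremum
  above is taken over a nonempty bounded set.
\<close>

lemma L2_norm_eq: "L2_norm d f = sqrt (\<Sum>s\<in>UNIV. (cmod (f s))\<^sup>2 * d s)"
  by (simp add: L2_norm_def L2_inner_def complex_norm_square[symmetric] flip: of_real_power)

lemma L2_0_iff: "f \<in> L2_0 d \<longleftrightarrow> (\<Sum>s\<in>UNIV. f s * of_real (d s)) = 0"
proof -
  have "L2_inner d f (\<lambda>_. c) = cnj c * (\<Sum>s\<in>UNIV. f s * of_real (d s))" for c
    unfolding L2_inner_def sum_distrib_left by (rule sum.cong) (auto simp: algebra_simps)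
  then show ?thesis
    by (auto simp: L2_0_def dest: spec[of _ 1])
qed

lemma zero_in_L2_0: "(\<lambda>_. 0) \<in> L2_0 d"
  by (simp add: L2_0_iff)

lemma markov_op_in_L2_0:
  assumes "weight \<omega>" and "\<And>s. wdegree \<omega> s > 0" and "f \<in> L2_0 (wdegree \<omega>)"
  shows "markov_op \<omega> f \<in> L2_0 (wdegree \<omega>)"
proof -
  have "(\<Sum>s\<in>UNIV. markov_op \<omega> f s * of_real (wdegree \<omega> s))
      = (\<Sum>s\<in>UNIV. \<Sum>t\<in>UNIV. of_real (\<omega> s t) * f t)"
  proof (rule sum.cong)
    fix s show "markov_op \<omega> f s * of_real (wdegree \<omega> s) = (\<Sum>t\<in>UNIV. of_real (\<omega> s t) * f t)"
      using assms(2)[of s] by (simp add: markov_op_def)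
  qed simp
  also have "\<dots> = (\<Sum>t\<in>UNIV. \<Sum>s\<in>UNIV. of_real (\<omega> s t) * f t)"
    by (rule sum.swap)
  also have "\<dots> = (\<Sum>t\<in>UNIV. f t * of_real (wdegree \<omega> t))"
  proof (rule sum.cong)
    fix t
    have "wdegree \<omega> t = (\<Sum>s\<in>UNIV. \<omega> s t)"
      using assms(1) by (simp add: wdegree_def weight_def)
    then show "(\<Sum>s\<in>UNIV. of_real (\<omega> s t) * f t) = f t * of_real (wdegree \<omega> t)"
      by (simp only: of_real_sum sum_distrib_left mult.commute)
  qed simp
  finally show ?thesis
    using assms(3) by (simp add: L2_0_iff)
qed

lemma L2_norm_markov_op_le:
  assumes "weight \<omega>" and "\<And>s. wdegree \<omega> s > 0"
  shows "L2_norm (wdegree \<omega>) (markov_op \<omega> f) \<le> L2_norm (wdegree \<omega>) f"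
proof -
  have nn: "0 \<le> \<omega> s t" and sym: "\<omega> s t = \<omega> t s" for s t
    using assms(1) by (auto simp: weight_def)
  have le: "(cmod (markov_op \<omega> f s))\<^sup>2 * wdegree \<omega> s \<le> (\<Sum>t\<in>UNIV. \<omega> s t * (cmod (f t))\<^sup>2)" for s
  proof -
    let ?S = "\<Sum>t\<in>UNIV. \<omega> s t * (cmod (f t))\<^sup>2"
    have "cmod (\<Sum>t\<in>UNIV. of_real (\<omega> s t) * f t) \<le> (\<Sum>t\<in>UNIV. \<omega> s t * cmod (f t))"
      by (rule order_trans[OF norm_sum]) (simp add: norm_mult nn)
    then have "(cmod (\<Sum>t\<in>UNIV. of_real (\<omega> s t) * f t))\<^sup>2 \<le> (\<Sum>t\<in>UNIV. \<omega> s t * cmod (f t))\<^sup>2"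
      by (rule power_mono) simp
    also have "\<dots> = (\<Sum>t\<in>UNIV. sqrt (\<omega> s t) * (sqrt (\<omega> s t) * cmod (f t)))\<^sup>2"
      by (simp add: nn flip: mult.assoc)
    also have "\<dots> \<le> (\<Sum>t\<in>UNIV. (sqrt (\<omega> s t))\<^sup>2) * (\<Sum>t\<in>UNIV. (sqrt (\<omega> s t) * cmod (f t))\<^sup>2)"
      by (rule Cauchy_Schwarz_ineq_sum)
    also have "\<dots> = wdegree \<omega> s * ?S"
      by (simp add: nn power_mult_distrib wdegree_def)
    finally have "(cmod (\<Sum>t\<in>UNIV. of_real (\<omega> s t) * f t))\<^sup>2 \<le> wdegree \<omega> s * ?S" .
    then show ?thesis
      using assms(2)[of s]
      by (simp add: markov_op_def norm_divide power_divide power2_eq_square[of "wdegree \<omega> s"]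
          divide_le_eq mult.commute)
  qed
  have "(\<Sum>s\<in>UNIV. (cmod (markov_op \<omega> f s))\<^sup>2 * wdegree \<omega> s)
      \<le> (\<Sum>s\<in>UNIV. \<Sum>t\<in>UNIV. \<omega> s t * (cmod (f t))\<^sup>2)"
    by (rule sum_mono) (rule le)
  also have "\<dots> = (\<Sum>t\<in>UNIV. \<Sum>s\<in>UNIV. \<omega> t s * (cmod (f t))\<^sup>2)"
    by (subst sum.swap) (simp add: sym)
  also have "\<dots> = (\<Sum>t\<in>UNIV. (cmod (f t))\<^sup>2 * wdegree \<omega> t)"
    unfolding wdegree_def sum_distrib_left by (simp only: mult.commute)
  finally show ?thesis
    by (simp add: L2_norm_eq)
qed

lemma markov_norm0_bdd_above:
  assumes "weight \<omega>" and "\<And>s. wdegree \<omega> s > 0"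
  shows "bdd_above ((\<lambda>f. L2_norm (wdegree \<omega>) (markov_op \<omega> f) / L2_norm (wdegree \<omega>) f)
    ` L2_0 (wdegree \<omega>))"
proof (rule bdd_aboveI2)
  fix f
  have "0 \<le> L2_norm (wdegree \<omega>) f"
    using assms(2) by (simp add: L2_norm_eq sum_nonneg less_imp_le)
  then show "L2_norm (wdegree \<omega>) (markov_op \<omega> f) / L2_norm (wdegree \<omega>) f \<le> 1"
    using L2_norm_markov_op_le[OF assms, of f] by (auto simp: divide_le_eq_1)
qed

end

theory Submission
  imports Defs
begin

text \<open>
  All the operators are read off from the sesquilinear form
  \<open>B\<^sub>\<omega>(f,g) = \<langle>A\<^sub>\<omega> f, g\<rangle> = \<Sum>\<^sub>s\<^sub>,\<^sub>t \<omega>(s,t) f(t) cnj (g(s))\<close>, which, unlike \<open>A\<^sub>\<omega>\<close> itself, is additive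
  in \<open>\<omega>\<close>. Write \<open>m\<close> for the larger of the two norms and \<open>d\<^sub>i\<close> for the degree of \<open>\<omega>\<^sub>i\<close>.

  Split \<open>f\<close> and \<open>g\<close> into their \<open>d\<^sub>i\<close>-mean and a part in \<open>L\<^sup>2\<^sub>0(V,d\<^sub>i)\<close>. The form \<open>B\<^sub>i\<close> respects this
  orthogonal splitting, acts as the identity on constants and has norm at most \<open>m\<close> on the
  complement. Hence the diagonal values of \<open>B\<^sub>i\<close> are bounded by
  \<open>m \<parallel>f\<parallel>\<^sub>i\<^sup>2 + (1 - m) \<bar>\<Sum>\<^sub>s f(s) d\<^sub>i(s)\<bar>\<^sup>2 / D\<^sub>i\<close>, and its values at \<open>(f,g)\<close> by the average of
  this quantity over \<open>f\<close> and \<open>g\<close> (lemma \<open>edge_form_bound\<close>).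

  If \<open>f\<close> is orthogonal to the constants for \<open>d\<^sub>1 + d\<^sub>2\<close>, its two weighted sums are opposite, and they
  are small because both degree functions are close to constant: with
  \<open>\<epsilon> = d\<^sub>1/D\<^sub>1 - d\<^sub>2/D\<^sub>2\<close>, the two mean contributions add up to
  \<open>D\<^sub>1D\<^sub>2/(D\<^sub>1+D\<^sub>2) \<bar>\<Sum>\<^sub>s f(s) \<epsilon>(s)\<bar>\<^sup>2\<close>. By Cauchy--Schwarz this is at most
  \<open>(\<Sum>\<^sub>s \<bar>\<epsilon>(s)\<bar>) \<parallel>f\<parallel>\<^sup>2\<close>, and \<open>\<Sum>\<^sub>s \<bar>\<epsilon>(s)\<bar> \<le> \<delta>\<close> by comparing both terms of \<open>\<epsilon>\<close> with \<open>1/|V|\<close>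
  (lemma \<open>mean_contributions_le\<close>).

  Adding the bounds for \<open>i = 1, 2\<close> gives \<open>\<bar>B(f,g)\<bar> \<le> (m + (1 - m) \<delta>) (\<parallel>f\<parallel>\<^sup>2 + \<parallel>g\<parallel>\<^sup>2) / 2\<close> on
  \<open>L\<^sup>2\<^sub>0(V, d\<^sub>1 + d\<^sub>2)\<close>, and choosing \<open>g\<close> to be the multiple of \<open>A f\<close> with the norm of \<open>f\<close> turns this
  into the operator bound (lemma \<open>markov_norm0_leI\<close>). This last step is why
  the form is bounded at pairs \<open>(f,g)\<close> and not only on the diagonal.
\<close>

section \<open>The weighted inner product\<close>

lemma L2_norm_nonneg:
  assumes "\<And>s. 0 \<le> d s"
  shows "0 \<le> L2_norm d f"
  using assms by (simp add: L2_norm_eq sum_nonneg)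

lemma L2_norm_square:
  assumes "\<And>s. 0 \<le> d s"
  shows "(L2_norm d f)\<^sup>2 = (\<Sum>s\<in>UNIV. (cmod (f s))\<^sup>2 * d s)"
  using assms by (simp add: L2_norm_eq sum_nonneg)

lemma L2_norm_cmult: "L2_norm d (\<lambda>s. c * f s) = cmod c * L2_norm d f"
proof -
  have "(\<Sum>s\<in>UNIV. (cmod (c * f s))\<^sup>2 * d s) = (cmod c)\<^sup>2 * (\<Sum>s\<in>UNIV. (cmod (f s))\<^sup>2 * d s)"
    by (simp add: norm_mult power_mult_distrib sum_distrib_left mult.assoc)
  then show ?thesis
    by (simp add: L2_norm_eq real_sqrt_mult)
qed

lemma L2_inner_self:
  assumes "\<And>s. 0 \<le> d s"
  shows "L2_inner d f f = of_real ((L2_norm d f)\<^sup>2)"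
  unfolding L2_norm_square[OF assms] L2_inner_def
  by (simp add: complex_norm_square del: of_real_power)

lemma L2_Cauchy_Schwarz:
  assumes "\<And>s. 0 \<le> d s"
  shows "cmod (L2_inner d f g) \<le> L2_norm d f * L2_norm d g"
proof (rule power2_le_imp_le)
  have split: "sqrt (d s) * x * (sqrt (d s) * y) = x * y * d s" for s x y
  proof -
    have "sqrt (d s) * x * (sqrt (d s) * y) = x * y * (sqrt (d s) * sqrt (d s))"
      by (simp only: mult_ac)
    then show ?thesis
      by (simp add: assms)
  qed
  have "cmod (L2_inner d f g) \<le> (\<Sum>s\<in>UNIV. (sqrt (d s) * cmod (f s)) * (sqrt (d s) * cmod (g s)))"
    unfolding L2_inner_def
    by (rule order_trans[OF norm_sum]) (simp add: split norm_mult assms)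
  then have "(cmod (L2_inner d f g))\<^sup>2
      \<le> (\<Sum>s\<in>UNIV. (sqrt (d s) * cmod (f s)) * (sqrt (d s) * cmod (g s)))\<^sup>2"
    by (rule power_mono) simp
  also have "\<dots> \<le> (\<Sum>s\<in>UNIV. (sqrt (d s) * cmod (f s))\<^sup>2) * (\<Sum>s\<in>UNIV. (sqrt (d s) * cmod (g s))\<^sup>2)"
    by (rule Cauchy_Schwarz_ineq_sum)
  also have "\<dots> = (L2_norm d f * L2_norm d g)\<^sup>2"
    by (simp add: L2_norm_square assms power_mult_distrib mult.commute)
  finally show "(cmod (L2_inner d f g))\<^sup>2 \<le> (L2_norm d f * L2_norm d g)\<^sup>2" .
qed (simp add: L2_norm_nonneg assms)

text \<open>Pythagoras for the constant \<open>c\<close> and a function orthogonal to the constants.\<close>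
lemma L2_norm_square_add_const:
  assumes "\<And>s. 0 \<le> d s" and "h \<in> L2_0 d"
  shows "(L2_norm d (\<lambda>s. c + h s))\<^sup>2 = (cmod c)\<^sup>2 * (\<Sum>s\<in>UNIV. d s) + (L2_norm d h)\<^sup>2"
proof -
  have h: "(\<Sum>s\<in>UNIV. h s * of_real (d s)) = 0"
    using assms(2) by (simp add: L2_0_iff)
  have h': "(\<Sum>s\<in>UNIV. cnj (h s) * of_real (d s)) = 0"
    using arg_cong[OF h, of cnj] by simp
  have "complex_of_real ((L2_norm d (\<lambda>s. c + h s))\<^sup>2)
      = (\<Sum>s\<in>UNIV. c * cnj c * of_real (d s) + c * (cnj (h s) * of_real (d s))
          + cnj c * (h s * of_real (d s)) + h s * cnj (h s) * of_real (d s))"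
    unfolding L2_inner_self[OF assms(1), symmetric] L2_inner_def
    by (rule sum.cong) (auto simp: algebra_simps)
  also have "\<dots> = c * cnj c * of_real (\<Sum>s\<in>UNIV. d s) + L2_inner d h h"
    unfolding sum.distrib sum_distrib_left[symmetric] h h' of_real_sum L2_inner_def by simp
  also have "\<dots> = of_real ((cmod c)\<^sup>2 * (\<Sum>s\<in>UNIV. d s) + (L2_norm d h)\<^sup>2)"
    by (simp add: L2_inner_self[OF assms(1)] complex_norm_square flip: of_real_power)
  finally show ?thesis
    by (simp only: of_real_eq_iff)
qed

section \<open>The form of the Markov operator\<close>

definition edge_form :: "('v::finite \<Rightarrow> 'v \<Rightarrow> real) \<Rightarrow> ('v \<Rightarrow> complex) \<Rightarrow> ('v \<Rightarrow> complex) \<Rightarrow> complex"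
  where "edge_form \<omega> f g = (\<Sum>s\<in>UNIV. \<Sum>t\<in>UNIV. of_real (\<omega> s t) * f t * cnj (g s))"

lemma edge_form_eq_inner:
  assumes "\<And>s. wdegree \<omega> s > 0"
  shows "edge_form \<omega> f g = L2_inner (wdegree \<omega>) (markov_op \<omega> f) g"
  unfolding edge_form_def L2_inner_def markov_op_def
proof (rule sum.cong)
  fix s
  show "(\<Sum>t\<in>UNIV. of_real (\<omega> s t) * f t * cnj (g s))
      = 1 / of_real (wdegree \<omega> s) * (\<Sum>t\<in>UNIV. of_real (\<omega> s t) * f t) * cnj (g s)
        * of_real (wdegree \<omega> s)"
    unfolding sum_distrib_right[symmetric] using assms[of s] by simp
qed simp

lemma edge_form_add:
  "edge_form (\<lambda>s t. \<omega> s t + \<omega>' s t) f g = edge_form \<omega> f g + edge_form \<omega>' f g"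
  by (simp add: edge_form_def sum.distrib algebra_simps)

lemma wdegree_add: "wdegree (\<lambda>s t. \<omega> s t + \<omega>' s t) s = wdegree \<omega> s + wdegree \<omega>' s"
  by (simp add: wdegree_def sum.distrib)

lemma weight_add:
  assumes "weight \<omega>" and "weight \<omega>'"
  shows "weight (\<lambda>s t. \<omega> s t + \<omega>' s t)"
  using assms by (simp add: weight_def)

text \<open>
  The mixed terms are inner products with constants, so they vanish; symmetry of
  the weight is what makes both of them weighted sums.
\<close>
lemma edge_form_add_const:
  assumes "weight \<omega>" and "h \<in> L2_0 (wdegree \<omega>)" and "k \<in> L2_0 (wdegree \<omega>)"
  shows "edge_form \<omega> (\<lambda>s. a + h s) (\<lambda>s. b + k s)
    = a * cnj b * of_real (total_degree \<omega>) + edge_form \<omega> h k"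
proof -
  have sym: "\<omega> s t = \<omega> t s" for s t
    using assms(1) by (simp add: weight_def)
  have h: "(\<Sum>s\<in>UNIV. \<Sum>t\<in>UNIV. of_real (\<omega> s t) * h t) = 0"
  proof -
    have "(\<Sum>s\<in>UNIV. \<Sum>t\<in>UNIV. of_real (\<omega> s t) * h t) = (\<Sum>t\<in>UNIV. h t * of_real (wdegree \<omega> t))"
      unfolding wdegree_def of_real_sum sum_distrib_left
      by (subst sum.swap) (simp add: sym mult.commute)
    then show ?thesis using assms(2) by (simp add: L2_0_iff)
  qed
  have k: "(\<Sum>s\<in>UNIV. \<Sum>t\<in>UNIV. of_real (\<omega> s t) * cnj (k s)) = 0"
  proof -
    have "(\<Sum>s\<in>UNIV. \<Sum>t\<in>UNIV. of_real (\<omega> s t) * cnj (k s))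
        = cnj (\<Sum>s\<in>UNIV. k s * of_real (wdegree \<omega> s))"
      unfolding wdegree_def of_real_sum sum_distrib_left by (simp add: mult.commute)
    then show ?thesis using assms(3) by (simp only: L2_0_iff complex_cnj_zero)
  qed
  have "edge_form \<omega> (\<lambda>s. a + h s) (\<lambda>s. b + k s)
      = (\<Sum>s\<in>UNIV. \<Sum>t\<in>UNIV. a * cnj b * of_real (\<omega> s t) + cnj b * (of_real (\<omega> s t) * h t)
          + a * (of_real (\<omega> s t) * cnj (k s)) + of_real (\<omega> s t) * h t * cnj (k s))"
    unfolding edge_form_def by (intro sum.cong) (auto simp: algebra_simps)
  also have "\<dots> = a * cnj b * of_real (total_degree \<omega>) + edge_form \<omega> h k"
    unfolding sum.distrib sum_distrib_left[symmetric] h k edge_form_def total_degree_def wdegree_def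
      of_real_sum by simp
  finally show ?thesis .
qed

section \<open>The norm on the complement of the constants\<close>

lemma markov_norm0_nonneg:
  assumes "weight \<omega>" and "\<And>s. wdegree \<omega> s > 0"
  shows "0 \<le> markov_norm0 \<omega>"
  unfolding markov_norm0_def L2_opnorm_on_def
proof (rule cSUP_upper2)
  show "0 \<le> L2_norm (wdegree \<omega>) (markov_op \<omega> (\<lambda>_. 0)) / L2_norm (wdegree \<omega>) (\<lambda>_. 0)"
    by (simp add: L2_norm_eq)
qed (use markov_norm0_bdd_above[OF assms] zero_in_L2_0 in auto)

lemma markov_norm0_le_1:
  assumes "weight \<omega>" and "\<And>s. wdegree \<omega> s > 0"
  shows "markov_norm0 \<omega> \<le> 1"
  unfolding markov_norm0_def L2_opnorm_on_def
proof (rule cSUP_least)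
  fix f
  have "0 \<le> L2_norm (wdegree \<omega>) f"
    by (rule L2_norm_nonneg) (use assms(2) less_imp_le in blast)
  then show "L2_norm (wdegree \<omega>) (markov_op \<omega> f) / L2_norm (wdegree \<omega>) f \<le> 1"
    using L2_norm_markov_op_le[OF assms, of f] by (auto simp: divide_le_eq_1)
qed (use zero_in_L2_0 in auto)

lemma L2_norm_markov_op_le_norm0:
  assumes "weight \<omega>" and "\<And>s. wdegree \<omega> s > 0" and "f \<in> L2_0 (wdegree \<omega>)"
  shows "L2_norm (wdegree \<omega>) (markov_op \<omega> f) \<le> markov_norm0 \<omega> * L2_norm (wdegree \<omega>) f"
proof (cases "L2_norm (wdegree \<omega>) f = 0")
  case True
  then show ?thesis
    using L2_norm_markov_op_le[OF assms(1,2), of f] by simp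
next
  case False
  have "0 \<le> L2_norm (wdegree \<omega>) f"
    by (rule L2_norm_nonneg) (use assms(2) less_imp_le in blast)
  moreover have "L2_norm (wdegree \<omega>) (markov_op \<omega> f) / L2_norm (wdegree \<omega>) f \<le> markov_norm0 \<omega>"
    unfolding markov_norm0_def L2_opnorm_on_def
    by (rule cSUP_upper[OF assms(3) markov_norm0_bdd_above[OF assms(1,2)]])
  ultimately show ?thesis
    using False by (simp add: divide_le_eq)
qed

text \<open>
  Testing the form on \<open>f\<close> and on the multiple of \<open>A f\<close> that has the norm of \<open>f\<close> recovers the product
  of the norms of \<open>A f\<close> and \<open>f\<close>.
\<close>
lemma markov_norm0_leI:
  assumes "weight \<omega>" and "\<And>s. wdegree \<omega> s > 0" and "0 \<le> K"
    and bound: "\<And>f g. f \<in> L2_0 (wdegree \<omega>) \<Longrightarrow> g \<in> L2_0 (wdegree \<omega>) \<Longrightarrow>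
      2 * cmod (edge_form \<omega> f g) \<le> K * ((L2_norm (wdegree \<omega>) f)\<^sup>2 + (L2_norm (wdegree \<omega>) g)\<^sup>2)"
  shows "markov_norm0 \<omega> \<le> K"
  unfolding markov_norm0_def L2_opnorm_on_def
proof (rule cSUP_least)
  fix f assume f: "f \<in> L2_0 (wdegree \<omega>)"
  let ?N = "L2_norm (wdegree \<omega>)" and ?A = "markov_op \<omega> f"
  have nn: "0 \<le> wdegree \<omega> s" for s
    using assms(2) less_imp_le by blast
  show "?N ?A / ?N f \<le> K"
  proof (cases "?N f = 0 \<or> ?N ?A = 0")
    case True
    then show ?thesis using assms(3) by auto
  next
    case False
    then have pos: "?N f > 0" "?N ?A > 0"
      using L2_norm_nonneg[of "wdegree \<omega>", OF nn] by (metis less_le)+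
    define r where "r = ?N f / ?N ?A"
    let ?g = "\<lambda>s. of_real r * ?A s"
    have g: "?g \<in> L2_0 (wdegree \<omega>)"
      using markov_op_in_L2_0[OF assms(1,2) f]
      by (simp add: L2_0_iff mult.assoc flip: sum_distrib_left)
    have Ng: "?N ?g = ?N f"
      unfolding L2_norm_cmult norm_of_real using pos by (simp add: r_def)
    have "edge_form \<omega> f ?g = of_real r * L2_inner (wdegree \<omega>) ?A ?A"
      unfolding edge_form_eq_inner[OF assms(2)] L2_inner_def sum_distrib_left
      by (simp add: mult_ac)
    also have "\<dots> = of_real (r * (?N ?A)\<^sup>2)"
      by (simp add: L2_inner_self[OF nn])
    also have "r * (?N ?A)\<^sup>2 = ?N f * ?N ?A"
      using pos by (simp add: r_def power2_eq_square)
    finally have "cmod (edge_form \<omega> f ?g) = ?N f * ?N ?A"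
      using pos by (simp add: norm_mult)
    then have "?N f * ?N ?A \<le> ?N f * (K * ?N f)"
      using bound[OF f g] unfolding Ng by (simp add: power2_eq_square mult_ac)
    then show ?thesis
      using pos by (simp add: divide_le_eq)
  qed
qed (use zero_in_L2_0 in auto)

section \<open>One weight, arbitrary functions\<close>

lemma total_degree_pos:
  assumes "\<And>s. wdegree \<omega> s > 0"
  shows "total_degree \<omega> > 0"
  unfolding total_degree_def by (rule sum_pos) (use assms in auto)

lemma mean_decomposition:
  assumes "\<And>s. wdegree \<omega> s > 0"
  obtains a h where "f = (\<lambda>s. a + h s)" and "h \<in> L2_0 (wdegree \<omega>)"
    and "(cmod a)\<^sup>2 * total_degree \<omega>
      = (cmod (\<Sum>s\<in>UNIV. f s * of_real (wdegree \<omega> s)))\<^sup>2 / total_degree \<omega>"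
proof
  let ?D = "total_degree \<omega>" and ?p = "\<Sum>s\<in>UNIV. f s * of_real (wdegree \<omega> s)"
  let ?a = "?p / of_real ?D"
  have D: "?D > 0"
    by (rule total_degree_pos[OF assms])
  show "f = (\<lambda>s. ?a + (f s - ?a))"
    by simp
  have "(\<Sum>s\<in>UNIV. (f s - ?a) * of_real (wdegree \<omega> s)) = ?p - ?a * of_real ?D"
    by (simp only: left_diff_distrib sum_subtractf total_degree_def of_real_sum sum_distrib_left)
  also have "\<dots> = 0"
    using D by simp
  finally show "(\<lambda>s. f s - ?a) \<in> L2_0 (wdegree \<omega>)"
    by (simp add: L2_0_iff)
  show "(cmod ?a)\<^sup>2 * ?D = (cmod ?p)\<^sup>2 / ?D"
    using D by (simp add: norm_divide power_divide power2_eq_square)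
qed

text \<open>
  On constants the form is the inner product, on their complement it is bounded by the
  operator norm; the remaining products are split by the inequality of arithmetic and
  geometric means.
\<close>
lemma edge_form_bound:
  assumes "weight \<omega>" and "\<And>s. wdegree \<omega> s > 0" and "markov_norm0 \<omega> \<le> m"
  defines "p \<equiv> \<lambda>f. (cmod (\<Sum>s\<in>UNIV. f s * of_real (wdegree \<omega> s)))\<^sup>2 / total_degree \<omega>"
  shows "2 * cmod (edge_form \<omega> f g)
    \<le> m * ((L2_norm (wdegree \<omega>) f)\<^sup>2 + (L2_norm (wdegree \<omega>) g)\<^sup>2) + (1 - m) * (p f + p g)"
proof -
  let ?N = "L2_norm (wdegree \<omega>)" and ?D = "total_degree \<omega>"
  have nn: "0 \<le> wdegree \<omega> s" for s
    using assms(2) less_imp_le by blast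
  have D: "?D > 0"
    by (rule total_degree_pos[OF assms(2)])
  obtain a h where f: "f = (\<lambda>s. a + h s)" and h: "h \<in> L2_0 (wdegree \<omega>)"
    and a: "(cmod a)\<^sup>2 * ?D = p f"
    unfolding p_def by (rule mean_decomposition[OF assms(2)])
  obtain b k where g: "g = (\<lambda>s. b + k s)" and k: "k \<in> L2_0 (wdegree \<omega>)"
    and b: "(cmod b)\<^sup>2 * ?D = p g"
    unfolding p_def by (rule mean_decomposition[OF assms(2)])
  have Nf: "(?N f)\<^sup>2 = p f + (?N h)\<^sup>2" and Ng: "(?N g)\<^sup>2 = p g + (?N k)\<^sup>2"
    using L2_norm_square_add_const[OF nn h, of a] L2_norm_square_add_const[OF nn k, of b]
    unfolding total_degree_def[symmetric] a b by (simp_all add: f g)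
  have Nnn: "0 \<le> ?N u" for u
    by (rule L2_norm_nonneg[OF nn])
  have m: "0 \<le> m"
    using markov_norm0_nonneg[OF assms(1,2)] assms(3) by linarith
  have "cmod (edge_form \<omega> h k) \<le> ?N (markov_op \<omega> h) * ?N k"
    unfolding edge_form_eq_inner[OF assms(2)] by (rule L2_Cauchy_Schwarz[OF nn])
  also have "\<dots> \<le> (m * ?N h) * ?N k"
    by (rule mult_right_mono[OF order_trans[OF L2_norm_markov_op_le_norm0[OF assms(1,2) h]]])
      (auto intro!: mult_right_mono Nnn assms(3))
  finally have "2 * cmod (edge_form \<omega> h k) \<le> m * (2 * ?N h * ?N k)"
    by (simp add: mult_ac)
  also have "\<dots> \<le> m * ((?N h)\<^sup>2 + (?N k)\<^sup>2)"
    by (rule mult_left_mono[OF sum_squares_bound m])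
  finally have hk: "2 * cmod (edge_form \<omega> h k) \<le> m * ((?N h)\<^sup>2 + (?N k)\<^sup>2)" .
  have "2 * cmod (a * cnj b * of_real ?D) = (2 * cmod a * cmod b) * ?D"
    using D by (simp add: norm_mult)
  also have "\<dots> \<le> ((cmod a)\<^sup>2 + (cmod b)\<^sup>2) * ?D"
    by (rule mult_right_mono[OF sum_squares_bound]) (use D in simp)
  also have "\<dots> = p f + p g"
    by (simp add: distrib_right a b)
  finally have ab: "2 * cmod (a * cnj b * of_real ?D) \<le> p f + p g" .
  have "2 * cmod (edge_form \<omega> f g)
      \<le> 2 * cmod (a * cnj b * of_real ?D) + 2 * cmod (edge_form \<omega> h k)"
    unfolding f g edge_form_add_const[OF assms(1) h k]
    using norm_triangle_ineq[of "a * cnj b * of_real ?D" "edge_form \<omega> h k"] by linarith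
  also have "\<dots> \<le> p f + p g + m * ((?N h)\<^sup>2 + (?N k)\<^sup>2)"
    using ab hk by linarith
  finally show ?thesis
    unfolding Nf Ng by (simp add: algebra_simps)
qed

section \<open>Two nearly constant degree functions\<close>

text \<open>
  The pointwise inequality behind the Cauchy--Schwarz step: writing \<open>a = x/X\<close> and \<open>b = y/Y\<close>, the
  difference \<open>\<bar>a - b\<bar>\<close> is at most the larger of \<open>a\<close> and \<open>b\<close>, whose multiple by \<open>X\<close> or \<open>Y\<close> is at most
  \<open>x + y\<close>.
\<close>
lemma square_diff_ratio_le:
  fixes x y X Y :: real
  assumes "x > 0" and "y > 0" and "X > 0" and "Y > 0"
  shows "X * Y / (X + Y) * ((x / X - y / Y)\<^sup>2 / (x + y)) \<le> \<bar>x / X - y / Y\<bar>"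
proof -
  have "X * Y * \<bar>x / X - y / Y\<bar> = \<bar>x * Y - y * X\<bar>"
  proof -
    have "X * Y * \<bar>x / X - y / Y\<bar> = \<bar>X * Y * (x / X - y / Y)\<bar>"
      using assms by (simp add: abs_mult)
    also have "X * Y * (x / X - y / Y) = x * Y - y * X"
      using assms by (simp add: field_simps)
    finally show ?thesis .
  qed
  also have "\<dots> \<le> x * Y + y * X"
    using assms by (simp add: abs_le_iff)
  also have "\<dots> \<le> (X + Y) * (x + y)"
    using assms by (simp add: algebra_simps)
  finally have "X * Y * \<bar>x / X - y / Y\<bar> / ((X + Y) * (x + y)) \<le> 1"
    using assms by (simp add: divide_le_eq)
  then have "X * Y * \<bar>x / X - y / Y\<bar> / ((X + Y) * (x + y)) * \<bar>x / X - y / Y\<bar> \<le> 1 * \<bar>x / X - y / Y\<bar>"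
    by (rule mult_right_mono) simp
  then show ?thesis
    by (simp add: power2_eq_square)
qed

lemma mean_contributions_le:
  fixes d\<^sub>1 d\<^sub>2 :: "'v::finite \<Rightarrow> real"
  assumes pos: "\<And>s. d\<^sub>1 s > 0" "\<And>s. d\<^sub>2 s > 0"
    and f: "f \<in> L2_0 (\<lambda>s. d\<^sub>1 s + d\<^sub>2 s)"
  defines "D\<^sub>1 \<equiv> \<Sum>s\<in>UNIV. d\<^sub>1 s" and "D\<^sub>2 \<equiv> \<Sum>s\<in>UNIV. d\<^sub>2 s"
  shows "(cmod (\<Sum>s\<in>UNIV. f s * of_real (d\<^sub>1 s)))\<^sup>2 / D\<^sub>1 + (cmod (\<Sum>s\<in>UNIV. f s * of_real (d\<^sub>2 s)))\<^sup>2 / D\<^sub>2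
    \<le> (\<Sum>s\<in>UNIV. \<bar>d\<^sub>1 s / D\<^sub>1 - d\<^sub>2 s / D\<^sub>2\<bar>) * (L2_norm (\<lambda>s. d\<^sub>1 s + d\<^sub>2 s) f)\<^sup>2"
proof -
  define d where "d = (\<lambda>s. d\<^sub>1 s + d\<^sub>2 s)"
  define \<epsilon> where "\<epsilon> = (\<lambda>s. d\<^sub>1 s / D\<^sub>1 - d\<^sub>2 s / D\<^sub>2)"
  define p where "p = (\<Sum>s\<in>UNIV. f s * of_real (d\<^sub>1 s))"
  define c where "c = D\<^sub>1 * D\<^sub>2 / (D\<^sub>1 + D\<^sub>2)"
  have dpos: "d s > 0" for s
    using pos[of s] by (simp add: d_def)
  then have dnn: "0 \<le> d s" for s
    by (simp add: less_imp_le)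
  have D: "D\<^sub>1 > 0" "D\<^sub>2 > 0"
    unfolding D\<^sub>1_def D\<^sub>2_def using pos by (auto intro!: sum_pos)
  then have c: "c > 0"
    by (simp add: c_def)
  have p2: "(\<Sum>s\<in>UNIV. f s * of_real (d\<^sub>2 s)) = - p"
  proof -
    have "p + (\<Sum>s\<in>UNIV. f s * of_real (d\<^sub>2 s)) = 0"
      using f by (simp add: L2_0_iff p_def distrib_left sum.distrib)
    then show ?thesis
      by (simp add: add_eq_0_iff)
  qed
  have "(\<Sum>s\<in>UNIV. f s * of_real (\<epsilon> s)) = p / of_real D\<^sub>1 - (- p) / of_real D\<^sub>2"
    unfolding p2[symmetric] unfolding p_def
    by (simp add: \<epsilon>_def right_diff_distrib sum_subtractf sum_divide_distrib)
  also have "\<dots> = of_real (1 / c) * p"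
    using D by (simp add: c_def field_simps)
  finally have p: "p = of_real c * (\<Sum>s\<in>UNIV. f s * of_real (\<epsilon> s))"
    using c by simp
  \<comment> \<open>Both contributions equal the same square, over \<open>D\<^sub>1\<close> and \<open>D\<^sub>2\<close>, and \<open>1/D\<^sub>1 + 1/D\<^sub>2 = 1/c\<close>.\<close>
  have "(cmod p)\<^sup>2 / D\<^sub>1 + (cmod (- p))\<^sup>2 / D\<^sub>2 = (cmod p)\<^sup>2 / c"
    using D by (simp add: c_def field_simps)
  also have "\<dots> = c * (cmod (\<Sum>s\<in>UNIV. f s * of_real (\<epsilon> s)))\<^sup>2"
    using c unfolding p by (simp add: norm_mult power_mult_distrib power2_eq_square)
  also have "(\<Sum>s\<in>UNIV. f s * of_real (\<epsilon> s)) = L2_inner d f (\<lambda>s. of_real (\<epsilon> s / d s))"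
    using dpos[THEN less_imp_neq] by (simp add: L2_inner_def)
  also have "c * (cmod \<dots>)\<^sup>2 \<le> c * (L2_norm d f * L2_norm d (\<lambda>s. of_real (\<epsilon> s / d s)))\<^sup>2"
    using c by (intro mult_left_mono power_mono L2_Cauchy_Schwarz dnn) auto
  also have "\<dots> = (\<Sum>s\<in>UNIV. c * ((\<epsilon> s)\<^sup>2 / d s)) * (L2_norm d f)\<^sup>2"
  proof -
    have "(cmod (of_real (\<epsilon> s / d s)))\<^sup>2 * d s = (\<epsilon> s)\<^sup>2 / d s" for s
      using dpos[of s] by (simp only: norm_of_real power2_abs) (simp add: power_divide power2_eq_square)
    then have "(L2_norm d (\<lambda>s. of_real (\<epsilon> s / d s)))\<^sup>2 = (\<Sum>s\<in>UNIV. (\<epsilon> s)\<^sup>2 / d s)"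
      by (simp only: L2_norm_square[OF dnn])
    then show ?thesis
      by (simp only: power_mult_distrib sum_distrib_left[symmetric] mult_ac)
  qed
  also have "\<dots> \<le> (\<Sum>s\<in>UNIV. \<bar>\<epsilon> s\<bar>) * (L2_norm d f)\<^sup>2"
    unfolding c_def \<epsilon>_def d_def
    by (intro mult_right_mono sum_mono square_diff_ratio_le pos D) auto
  finally show ?thesis
    by (simp only: p2 \<epsilon>_def d_def p_def[symmetric])
qed

section \<open>The sum of two weights\<close>

theorem proposition6p5:
  fixes \<omega>\<^sub>1 \<omega>\<^sub>2 :: "'v::finite \<Rightarrow> 'v \<Rightarrow> real"
    and D\<^sub>1 D\<^sub>2 \<delta> :: real
  assumes "weight \<omega>\<^sub>1" and "weight \<omega>\<^sub>2"
    and "\<And>s. wdegree \<omega>\<^sub>1 s > 0" and "\<And>s. wdegree \<omega>\<^sub>2 s > 0"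
    and "D\<^sub>1 = total_degree \<omega>\<^sub>1" and "D\<^sub>2 = total_degree \<omega>\<^sub>2"
    and "\<delta> = (\<Sum>s\<in>UNIV. \<bar>wdegree \<omega>\<^sub>1 s - D\<^sub>1 / real CARD('v)\<bar> / D\<^sub>1
                      + \<bar>wdegree \<omega>\<^sub>2 s - D\<^sub>2 / real CARD('v)\<bar> / D\<^sub>2)"
  shows "markov_norm0 (\<lambda>s t. \<omega>\<^sub>1 s t + \<omega>\<^sub>2 s t)
           \<le> \<delta> + (1 - \<delta>) * max (markov_norm0 \<omega>\<^sub>1) (markov_norm0 \<omega>\<^sub>2)"
proof -
  define m where "m = max (markov_norm0 \<omega>\<^sub>1) (markov_norm0 \<omega>\<^sub>2)"
  define K where "K = m + (1 - m) * \<delta>"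
  let ?\<omega> = "\<lambda>s t. \<omega>\<^sub>1 s t + \<omega>\<^sub>2 s t"
  let ?d\<^sub>1 = "wdegree \<omega>\<^sub>1" and ?d\<^sub>2 = "wdegree \<omega>\<^sub>2"
  let ?N = "L2_norm (wdegree ?\<omega>)"
  have m: "0 \<le> m" "m \<le> 1"
    using markov_norm0_nonneg[OF assms(1,3)] markov_norm0_le_1[OF assms(1,3)]
      markov_norm0_le_1[OF assms(2,4)] by (auto simp: m_def)
  have D: "D\<^sub>1 > 0" "D\<^sub>2 > 0"
    using total_degree_pos[OF assms(3)] total_degree_pos[OF assms(4)] assms(5,6) by auto
  have \<delta>: "0 \<le> \<delta>"
    unfolding assms(7) using D by (auto intro!: sum_nonneg add_nonneg_nonneg divide_nonneg_pos)
  have d: "wdegree ?\<omega> = (\<lambda>s. ?d\<^sub>1 s + ?d\<^sub>2 s)"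
    by (simp add: fun_eq_iff wdegree_add)
  have nn: "0 \<le> ?d\<^sub>1 s" "0 \<le> ?d\<^sub>2 s" "0 \<le> wdegree ?\<omega> s" for s
    using assms(3,4)[of s] by (auto simp: d)
  have N: "(?N f)\<^sup>2 = (L2_norm ?d\<^sub>1 f)\<^sup>2 + (L2_norm ?d\<^sub>2 f)\<^sup>2" for f
    by (simp add: L2_norm_square nn) (simp add: d distrib_left sum.distrib)
  have \<epsilon>: "(\<Sum>s\<in>UNIV. \<bar>?d\<^sub>1 s / D\<^sub>1 - ?d\<^sub>2 s / D\<^sub>2\<bar>) \<le> \<delta>"
    unfolding assms(7)
  proof (rule sum_mono)
    fix s
    let ?u = "1 / real CARD('v)"
    have "\<bar>?d\<^sub>1 s - D\<^sub>1 / real CARD('v)\<bar> / D\<^sub>1 = \<bar>?d\<^sub>1 s / D\<^sub>1 - ?u\<bar>"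
      "\<bar>?d\<^sub>2 s - D\<^sub>2 / real CARD('v)\<bar> / D\<^sub>2 = \<bar>?d\<^sub>2 s / D\<^sub>2 - ?u\<bar>"
      using abs_div_pos[OF D(1), of "?d\<^sub>1 s - D\<^sub>1 / real CARD('v)"]
        abs_div_pos[OF D(2), of "?d\<^sub>2 s - D\<^sub>2 / real CARD('v)"] D
      by (simp_all add: diff_divide_distrib)
    then show "\<bar>?d\<^sub>1 s / D\<^sub>1 - ?d\<^sub>2 s / D\<^sub>2\<bar> \<le> \<bar>?d\<^sub>1 s - D\<^sub>1 / real CARD('v)\<bar> / D\<^sub>1
        + \<bar>?d\<^sub>2 s - D\<^sub>2 / real CARD('v)\<bar> / D\<^sub>2"
      by linarith
  qed
  define p\<^sub>1 where "p\<^sub>1 f = (cmod (\<Sum>s\<in>UNIV. f s * of_real (?d\<^sub>1 s)))\<^sup>2 / D\<^sub>1" for f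
  define p\<^sub>2 where "p\<^sub>2 f = (cmod (\<Sum>s\<in>UNIV. f s * of_real (?d\<^sub>2 s)))\<^sup>2 / D\<^sub>2" for f
  have p: "p\<^sub>1 f + p\<^sub>2 f \<le> \<delta> * (?N f)\<^sup>2" if "f \<in> L2_0 (wdegree ?\<omega>)" for f
  proof -
    have "p\<^sub>1 f + p\<^sub>2 f \<le> (\<Sum>s\<in>UNIV. \<bar>?d\<^sub>1 s / D\<^sub>1 - ?d\<^sub>2 s / D\<^sub>2\<bar>) * (?N f)\<^sup>2"
      using mean_contributions_le[of ?d\<^sub>1 ?d\<^sub>2 f] assms(3-6) that
      by (simp add: p\<^sub>1_def p\<^sub>2_def d total_degree_def)
    also have "\<dots> \<le> \<delta> * (?N f)\<^sup>2"
      by (rule mult_right_mono[OF \<epsilon>]) simp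
    finally show ?thesis .
  qed
  have "markov_norm0 ?\<omega> \<le> K"
  proof (rule markov_norm0_leI)
    show "weight ?\<omega>"
      by (rule weight_add[OF assms(1,2)])
    show "wdegree ?\<omega> s > 0" for s
      using assms(3,4)[of s] by (simp add: d)
    show "0 \<le> K"
      using m \<delta> by (simp add: K_def)
    fix f g
    assume f: "f \<in> L2_0 (wdegree ?\<omega>)" and g: "g \<in> L2_0 (wdegree ?\<omega>)"
    have "2 * cmod (edge_form ?\<omega> f g) \<le> 2 * cmod (edge_form \<omega>\<^sub>1 f g) + 2 * cmod (edge_form \<omega>\<^sub>2 f g)"
      unfolding edge_form_add
      using norm_triangle_ineq[of "edge_form \<omega>\<^sub>1 f g" "edge_form \<omega>\<^sub>2 f g"] by linarith
    also have "\<dots> \<le> (m * ((L2_norm ?d\<^sub>1 f)\<^sup>2 + (L2_norm ?d\<^sub>1 g)\<^sup>2) + (1 - m) * (p\<^sub>1 f + p\<^sub>1 g))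
        + (m * ((L2_norm ?d\<^sub>2 f)\<^sup>2 + (L2_norm ?d\<^sub>2 g)\<^sup>2) + (1 - m) * (p\<^sub>2 f + p\<^sub>2 g))"
      using edge_form_bound[OF assms(1,3), of m f g] edge_form_bound[OF assms(2,4), of m f g]
      by (intro add_mono) (simp_all add: m_def p\<^sub>1_def p\<^sub>2_def assms(5,6))
    also have "\<dots> = m * ((?N f)\<^sup>2 + (?N g)\<^sup>2) + (1 - m) * ((p\<^sub>1 f + p\<^sub>2 f) + (p\<^sub>1 g + p\<^sub>2 g))"
      by (simp add: N algebra_simps)
    also have "\<dots> \<le> m * ((?N f)\<^sup>2 + (?N g)\<^sup>2) + (1 - m) * (\<delta> * (?N f)\<^sup>2 + \<delta> * (?N g)\<^sup>2)"
      using m p[OF f] p[OF g] by (intro add_left_mono mult_left_mono add_mono) auto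
    also have "\<dots> = K * ((?N f)\<^sup>2 + (?N g)\<^sup>2)"
      by (simp add: K_def algebra_simps)
    finally show "2 * cmod (edge_form ?\<omega> f g) \<le> K * ((?N f)\<^sup>2 + (?N g)\<^sup>2)" .
  qed
  also have "K = \<delta> + (1 - \<delta>) * m"
    by (simp add: K_def algebra_simps)
  finally show ?thesis
    unfolding m_def .
qed

end
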